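(* Consider an asynchronous shared-memory (read/write registers) system of $n$ processes in which up to $t$ processes may crash, with $n > 2t$. There is no algorithm that solves $k$-set agreement for any $k \le \lfloor \frac{n-t}{n-2t} \rfloor - 1$.
   Context: $k$-set agreement: each process proposes an initial value from a set $V$ of at least $k+1$ values and must irrevocably decide a value, such that (Validity) if all correct processes propose the same value $v$, no correct process decides a value different from $v$; (Agreement) at most $k$ distinct values are decided by correct processes; (Termination) every correct process eventually decides. A crashed process stops taking steps; a correct process never crashes. Asynchronous: no bounds on relative process speeds. *)

theory Defs
  imports Main "HOL-Library.Infinite_Set"
begin

text \<open>Processes are 0, ..., n-1. Shared memory is a collection of atomic
multi-writer multi-reader registers named by type 'r holding values of type 'm.
Each process runs a deterministic local algorithm with local states of type 's;
each step is one atomic read or write of a register.\<close>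

datatype ('r, 'm) oper = Rd 'r | Wr 'r 'm

record ('s, 'r, 'm, 'v) alg =
  init_st  :: "nat \<Rightarrow> 'v \<Rightarrow> 's"
  init_mem :: "'r \<Rightarrow> 'm"
  next_op  :: "nat \<Rightarrow> 's \<Rightarrow> ('r, 'm) oper"
  next_st  :: "nat \<Rightarrow> 's \<Rightarrow> 'm option \<Rightarrow> 's" \<comment> \<open>new local state (Some value read / None for a write)\<close>
  dec      :: "'s \<Rightarrow> 'v option"

type_synonym ('s, 'r, 'm) config = "(nat \<Rightarrow> 's) \<times> ('r \<Rightarrow> 'm)"

definition step :: "('s, 'r, 'm, 'v) alg \<Rightarrow> nat \<Rightarrow> ('s, 'r, 'm) config \<Rightarrow> ('s, 'r, 'm) config" where
  "step A p c = (let ls = fst c; mem = snd c in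
     case next_op A p (ls p) of
       Rd r \<Rightarrow> (ls(p := next_st A p (ls p) (Some (mem r))), mem)
     | Wr r x \<Rightarrow> (ls(p := next_st A p (ls p) None), mem(r := x)))"

primrec run :: "('s, 'r, 'm, 'v) alg \<Rightarrow> (nat \<Rightarrow> 'v) \<Rightarrow> (nat \<Rightarrow> nat) \<Rightarrow> nat \<Rightarrow> ('s, 'r, 'm) config" where
  "run A inp \<sigma> 0 = ((\<lambda>p. init_st A p (inp p)), init_mem A)"
| "run A inp \<sigma> (Suc i) = step A (\<sigma> i) (run A inp \<sigma> i)"

definition lstate :: "('s, 'r, 'm, 'v) alg \<Rightarrow> (nat \<Rightarrow> 'v) \<Rightarrow> (nat \<Rightarrow> nat) \<Rightarrow> nat \<Rightarrow> nat \<Rightarrow> 's" where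
  "lstate A inp \<sigma> i p = fst (run A inp \<sigma> i) p"

text \<open>A process is correct in a schedule iff it takes infinitely many steps;
otherwise it has crashed.\<close>
definition correct :: "(nat \<Rightarrow> nat) \<Rightarrow> nat \<Rightarrow> bool" where
  "correct \<sigma> p \<longleftrightarrow> (\<exists>\<^sub>\<infinity> i. \<sigma> i = p)"

definition admissible :: "nat \<Rightarrow> nat \<Rightarrow> (nat \<Rightarrow> nat) \<Rightarrow> bool" where
  "admissible n t \<sigma> \<longleftrightarrow> (\<forall>i. \<sigma> i < n) \<and> card {p. p < n \<and> \<not> correct \<sigma> p} \<le> t"

definition decides :: "('s, 'r, 'm, 'v) alg \<Rightarrow> (nat \<Rightarrow> 'v) \<Rightarrow> (nat \<Rightarrow> nat) \<Rightarrow> nat \<Rightarrow> 'v \<Rightarrow> bool" where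
  "decides A inp \<sigma> p v \<longleftrightarrow> (\<exists>i. dec A (lstate A inp \<sigma> i p) = Some v)"

definition solves_kset :: "nat \<Rightarrow> nat \<Rightarrow> nat \<Rightarrow> 'v set \<Rightarrow> ('s, 'r, 'm, 'v) alg \<Rightarrow> bool" where
  "solves_kset n t k V A \<longleftrightarrow>
    (\<forall>inp \<sigma>. (\<forall>p<n. inp p \<in> V) \<longrightarrow> admissible n t \<sigma> \<longrightarrow>
       \<comment> \<open>decisions are irrevocable\<close>
       (\<forall>p<n. \<forall>i v. dec A (lstate A inp \<sigma> i p) = Some v \<longrightarrow>
                    dec A (lstate A inp \<sigma> (Suc i) p) = Some v) \<and>
       \<comment> \<open>Validity\<close>
       (\<forall>v\<in>V. (\<forall>p<n. correct \<sigma> p \<longrightarrow> inp p = v) \<longrightarrow>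
          (\<forall>p<n. \<forall>w. correct \<sigma> p \<longrightarrow> decides A inp \<sigma> p w \<longrightarrow> w = v)) \<and>
       \<comment> \<open>Agreement\<close>
       card {w. \<exists>p<n. correct \<sigma> p \<and> decides A inp \<sigma> p w} \<le> k \<and>
       \<comment> \<open>Termination\<close>
       (\<forall>p<n. correct \<sigma> p \<longrightarrow> (\<exists>w. decides A inp \<sigma> p w)))"

end

(* Let g = n - 2t. Split the processes below n - t into k + 1 groups of at least g processes,
   one input value per group, and let the other t processes be silent. All non-silent processes
   are correct, hence decide. When a process of the group with value v decides, it cannot exclude
   that the t silent processes also propose v and that only they and its own group are correct.
   Together these are at least n - t processes, so Validity forces the decision v. Thus k + 1
   values are decided. *)
theory Submission
  imports Defs
begin

text \<open>A step depends only on the memory and the local state of the process that takes it, so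
  the input of a process that has not yet moved cannot influence anyone else.\<close>

lemma run_agree:
  assumes "\<And>p. p \<in> P \<Longrightarrow> inp p = inp' p"
    and "\<And>j. j < m \<Longrightarrow> \<sigma> j \<in> P"
    and "\<And>j. j < m \<Longrightarrow> \<sigma>' j = \<sigma> j"
  shows "snd (run A inp \<sigma> m) = snd (run A inp' \<sigma>' m) \<and>
    (\<forall>p\<in>P. lstate A inp \<sigma> m p = lstate A inp' \<sigma>' m p)"
  using assms(2,3)
proof (induction m)
  case 0
  then show ?case using assms(1) by (simp add: lstate_def)
next
  case (Suc m)
  have "snd (run A inp \<sigma> m) = snd (run A inp' \<sigma>' m)"
    and "\<forall>p\<in>P. lstate A inp \<sigma> m p = lstate A inp' \<sigma>' m p"
    using Suc by auto
  moreover have "\<sigma> m \<in> P" "\<sigma>' m = \<sigma> m"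
    using Suc.prems by auto
  ultimately show ?case
    by (auto simp: lstate_def step_def Let_def split: oper.split)
qed

text \<open>Correctness depends only on the tail of a schedule, so any finite prefix can be followed
  by a round-robin over \<open>S\<close>.\<close>

lemma schedule_extension:
  assumes "finite S" and "S \<noteq> {}"
  obtains \<sigma>' :: "nat \<Rightarrow> nat"
  where "\<And>j. j < m \<Longrightarrow> \<sigma>' j = \<sigma> j" and "\<And>j. m \<le> j \<Longrightarrow> \<sigma>' j \<in> S"
    and "\<And>p. correct \<sigma>' p \<longleftrightarrow> p \<in> S"
proof -
  obtain xs where xs: "set xs = S"
    using assms(1) finite_list by blast
  define l where "l = length xs"
  have "l > 0"
    using xs assms(2) by (auto simp: l_def)
  define \<sigma>' where "\<sigma>' j = (if j < m then \<sigma> j else xs ! (j mod l))" for j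
  have tail: "\<sigma>' j \<in> S" if "m \<le> j" for j
    using that \<open>l > 0\<close> xs by (auto simp: \<sigma>'_def l_def)
  have "correct \<sigma>' p" if p: "p \<in> S" for p
  proof -
    obtain i where i: "i < l" "xs ! i = p"
      using p xs by (auto simp: in_set_conv_nth l_def)
    have "\<exists>j\<ge>N. \<sigma>' j = p" for N
    proof (intro exI conjI)
      \<comment> \<open>The witness \<open>l * (N + m) + i\<close> lies beyond both \<open>N\<close>
        and the prefix, and is congruent to \<open>i\<close> modulo \<open>l\<close>.\<close>
      have "N + m \<le> l * (N + m)"
        using \<open>l > 0\<close> by simp
      then have "N + m \<le> l * (N + m) + i"
        by linarith
      then show "N \<le> l * (N + m) + i" and "\<sigma>' (l * (N + m) + i) = p"
        using i by (auto simp: \<sigma>'_def)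
    qed
    then show ?thesis
      by (simp add: correct_def INFM_nat_le)
  qed
  moreover have "p \<in> S" if "correct \<sigma>' p" for p
    using that tail unfolding correct_def INFM_nat_le by blast
  ultimately show thesis
    using that[of \<sigma>'] tail by (auto simp: \<sigma>'_def)
qed

text \<open>The decision is made after finitely many steps. Up to then \<open>p\<close> cannot tell
  the given run from one where the processes outside \<open>P\<close> have input \<open>v\<close>;
  afterwards that run can be continued so that Validity applies to it.\<close>

lemma decides_forced:
  assumes solves: "solves_kset n t k V A"
    and sched: "\<And>j. \<sigma> j \<in> P" and P: "P \<subseteq> {..<n}"
    and inp: "\<And>q. q < n \<Longrightarrow> inp q \<in> V"
    and p: "p \<in> P" "inp p = v"
    and few: "card {q \<in> P. inp q \<noteq> v} \<le> t"
    and dec: "decides A inp \<sigma> p w"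
  shows "w = v"
proof -
  obtain m where m: "dec A (lstate A inp \<sigma> m p) = Some w"
    using dec by (auto simp: decides_def)
  define inp' where "inp' q = (if q \<in> P then inp q else v)" for q
  \<comment> \<open>Outside \<open>P\<close> every input is now \<open>v\<close>, so the processes
    below \<open>n\<close> missing from \<open>S\<close> are those of \<open>P\<close> with another
    input. There are at most \<open>t\<close> of them, so all may crash after the prefix.\<close>
  define S where "S = {q. q < n \<and> inp' q = v}"
  have pS: "p \<in> S" and "finite S"
    using p P by (auto simp: S_def inp'_def)
  then obtain \<sigma>' where \<sigma>': "\<And>j. j < m \<Longrightarrow> \<sigma>' j = \<sigma> j" "\<And>j. m \<le> j \<Longrightarrow> \<sigma>' j \<in> S"
    "\<And>q. correct \<sigma>' q \<longleftrightarrow> q \<in> S"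
    using schedule_extension[of S m \<sigma>] by blast
  have "\<sigma>' j < n" for j
    using \<sigma>'(1,2)[of j] sched P by (cases "j < m") (auto simp: S_def)
  moreover have "{q. q < n \<and> \<not> correct \<sigma>' q} = {q \<in> P. inp q \<noteq> v}"
    using P by (auto simp: \<sigma>'(3) S_def inp'_def)
  ultimately have "admissible n t \<sigma>'"
    using few by (simp add: admissible_def)
  moreover have "\<forall>q<n. inp' q \<in> V"
    using inp p P by (auto simp: inp'_def)
  moreover have "v \<in> V"
    using inp p P by auto
  moreover have "\<forall>q<n. correct \<sigma>' q \<longrightarrow> inp' q = v"
    by (auto simp: \<sigma>'(3) S_def)
  moreover have "lstate A inp \<sigma> m p = lstate A inp' \<sigma>' m p"
    using run_agree[of P inp inp' m \<sigma> \<sigma>' A] sched \<sigma>'(1) p(1) by (auto simp: inp'_def)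
  then have "decides A inp' \<sigma>' p w"
    using m by (auto simp: decides_def)
  moreover have "correct \<sigma>' p" "p < n"
    using pS by (auto simp: \<sigma>'(3) S_def)
  ultimately show ?thesis
    using solves unfolding solves_kset_def by blast
qed

theorem theorem7:
  fixes n t k :: nat and V :: "'v set"
  assumes "n > 2 * t"
    and "k \<le> (n - t) div (n - 2 * t) - 1"
    and "\<exists>W \<subseteq> V. card W = k + 1"
  shows "\<not> (\<exists>A :: ('s, 'r, 'm, 'v) alg. solves_kset n t k V A)"
proof
  assume "\<exists>A :: ('s, 'r, 'm, 'v) alg. solves_kset n t k V A"
  then obtain A :: "('s, 'r, 'm, 'v) alg" where A: "solves_kset n t k V A" ..
  obtain W where W: "W \<subseteq> V" "card W = k + 1"
    using assms(3) by blast
  \<comment> \<open>An infinite set has cardinality 0, which differs from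
    \<open>k + 1\<close>.\<close>
  then have "finite W"
    using card.infinite by fastforce
  then obtain f where f: "bij_betw f {0..<k + 1} W"
    using W(2) ex_bij_betw_nat_finite by metis
  define g where "g = n - 2 * t"
  have "g > 0"
    using assms(1) by (simp add: g_def)
  \<comment> \<open>Subtraction is truncated, so the bound on \<open>k\<close> yields
    \<open>k + 1 \<le> (n - t) div g\<close> only once this quotient is known to be
    positive.\<close>
  have "1 \<le> (n - t) div g"
    using \<open>g > 0\<close> by (simp add: g_def div_greater_zero_iff Suc_le_eq)
  then have "k + 1 \<le> (n - t) div g"
    using assms(2) by (simp add: g_def)
  then have "(k + 1) * g \<le> n - t"
    using \<open>g > 0\<close> less_eq_div_iff_mult_less_eq by blast
  then have groups: "i * g + g \<le> n - t" if "i \<le> k" for i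
    using mult_le_mono1[OF that, of g] unfolding distrib_right mult_1 by linarith
  \<comment> \<open>Group \<open>i\<close> begins at process \<open>i * g\<close>. The
    \<open>min\<close> puts all processes from \<open>k * g\<close> on into the last group, which
    may thus be larger than \<open>g\<close>, and keeps every input in \<open>W\<close>.\<close>
  define inp where "inp p = f (min (p div g) k)" for p
  define P where "P = {..<n - t}"
  have PW: "inp p \<in> W" for p
    using bij_betwE[OF f] by (auto simp: inp_def)
  have minority: "card {q \<in> P. inp q \<noteq> f i} \<le> t" if "i \<le> k" for i
  proof -
    have sub: "{i * g..<i * g + g} \<subseteq> P"
      using groups[OF that] by (auto simp: P_def)
    have "q div g = i" if "q \<in> {i * g..<i * g + g}" for q
      using that by (intro div_nat_eqI) (auto simp: algebra_simps)
    then have "{q \<in> P. inp q \<noteq> f i} \<subseteq> P - {i * g..<i * g + g}"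
      using \<open>i \<le> k\<close> by (auto simp: inp_def)
    then have "card {q \<in> P. inp q \<noteq> f i} \<le> card (P - {i * g..<i * g + g})"
      by (intro card_mono) (auto simp: P_def)
    \<comment> \<open>Here the choice of \<open>g\<close> matters:
      \<open>(n - t) - (n - 2 * t)\<close> is \<open>t\<close>.\<close>
    also have "\<dots> = n - t - g"
      using sub by (subst card_Diff_subset) (auto simp: P_def)
    also have "\<dots> \<le> t"
      by (simp add: g_def)
    finally show ?thesis .
  qed
  have "P \<noteq> {}" "finite P"
    using assms(1) by (simp_all add: P_def lessThan_empty_iff)
  \<comment> \<open>With the empty prefix, the processes outside \<open>P\<close> never take a
    step.\<close>
  then obtain \<sigma> where \<sigma>: "\<And>j. \<sigma> j \<in> P" "\<And>p. correct \<sigma> p \<longleftrightarrow> p \<in> P"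
    using schedule_extension[of P 0] by (metis le0)
  have "{p. p < n \<and> \<not> correct \<sigma> p} = {n - t..<n}"
    by (auto simp: \<sigma>(2) P_def)
  moreover have "\<sigma> j < n" for j
    using \<sigma>(1)[of j] by (auto simp: P_def)
  ultimately have adm: "admissible n t \<sigma>"
    by (simp add: admissible_def)
  have inpV: "inp p \<in> V" for p
    using PW W(1) by auto
  have forced: "w = inp p" if "p \<in> P" "decides A inp \<sigma> p w" for p w
  proof (rule decides_forced[OF A \<sigma>(1) _ inpV \<open>p \<in> P\<close> refl _ that(2)])
    show "P \<subseteq> {..<n}"
      by (auto simp: P_def)
    show "card {q \<in> P. inp q \<noteq> inp p} \<le> t"
      unfolding inp_def[of p] by (rule minority) simp
  qed
  have spec: "card {w. \<exists>p<n. correct \<sigma> p \<and> decides A inp \<sigma> p w} \<le> k"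
    "\<forall>p<n. correct \<sigma> p \<longrightarrow> (\<exists>w. decides A inp \<sigma> p w)"
    using A adm inpV unfolding solves_kset_def by blast+
  have "w \<in> {w. \<exists>p<n. correct \<sigma> p \<and> decides A inp \<sigma> p w}" if "w \<in> W" for w
  proof -
    obtain i where i: "i \<le> k" "w = f i"
      using \<open>w \<in> W\<close> f by (auto simp: bij_betw_def less_Suc_eq_le)
    \<comment> \<open>The first process of group \<open>i\<close> is in \<open>P\<close>; it must
      decide, and its decision is \<open>f i\<close>.\<close>
    have p: "i * g < n - t" "i * g < n"
      using groups[OF i(1)] \<open>g > 0\<close> by linarith+
    then obtain u where u: "decides A inp \<sigma> (i * g) u"
      using spec(2) p \<sigma>(2) by (auto simp: P_def)
    then have "u = w"
      using forced[of "i * g" u] p i \<open>g > 0\<close> by (simp add: P_def inp_def)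
    then show ?thesis
      using p u \<sigma>(2) by (auto simp: P_def intro!: exI[of _ "i * g"])
  qed
  moreover have "{w. \<exists>p<n. correct \<sigma> p \<and> decides A inp \<sigma> p w} \<subseteq> W"
    using forced PW \<sigma>(2) by blast
  ultimately have "{w. \<exists>p<n. correct \<sigma> p \<and> decides A inp \<sigma> p w} = W"
    by blast
  then show False
    using spec(1) W(2) by simp
qed

end
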